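(* Let $c_{\min}\in(0,1]$ and consider instances of the Budgeted Influence Maximization with Augmentation problem (BIMA) in which every edge cost satisfies $c_e\ge c_{\min}$. For every fixed integer $M\ge 4$, the Enumeration Algorithm with parameter $M$ (defined in the context) achieves an approximation factor of $$1-\frac{1}{e^{\frac{c_{\min}}{1+c_{\min}}}},$$ i.e. on every such instance the solution $(A,S)$ it returns satisfies $c(A,S)\le k$ and $\sigma(A,S)\ge \Big(1-e^{-\frac{c_{\min}}{1+c_{\min}}}\Big)\,\sigma(A^*,S^* )$, where $(A^*,S^* )$ is an optimal solution.
   Context: Setting. $G=(V,E,p,c)$ is a finite directed graph with propagation probabilities $p:V\times V\to[0,1]$ and edge-addition costs $c:V\times V\to[0,1]$. Independent Cascade Model: for a set $S\subseteq (V\times V)\setminus E$, let $G(S)=(V,E\cup S)$. A live-edge graph $X$ of $G(S)$ is the random subgraph on $V$ in which each edge $e\in E\cup S$ is kept independently with probability $p_e$; $\chi(S)$ is the set of all possible live-edge graphs of $G(S)$. For $A\subseteq V$, $R(A,X)$ is the set of nodes reachable in $X$ from some node of $A$ (including $A$), and $\sigma(A,S)=\sum_{X\in\chi(S)}\mathbb P[X]\,|R(A,X)|$ is the expected number of active nodes when $A$ is the set of seeds in $G(S)$. BIMA problem: given $G$ and a budget $k\in\mathbb N$, find $A\subseteq V$ and $S\subseteq (A\times V)\setminus E$ with $c(A,S):=|A|+\sum_{e\in S}c_e\le k$ maximizing $\sigma(A,S)$. Exact evaluation of $\sigma$ is assumed available. For $A_2\subseteq A_1$, $S_2\subseteq S_1$,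 with the edges in $S_i$ outgoing from $A_i$, $\delta(A_1,S_1,A_2,S_2)=\sum_{X\in\chi(S_1)}\mathbb P[X](|R(A_1,X)|-|R(A_2,X^T)|)$ with $T=S_1\setminus S_2$ and $X^T$ the graph $X$ with the edges of $T$ removed; this equals $\sigma(A_1,S_1)-\sigma(A_2,S_2)$. Greedy phase, started from a solution $(A,S)$ with available nodes $U$ and available edges $T$: while $T\ne\emptyset$ or $U\neq\emptyset$, compute $r_1=\max_{a\in U}\delta(A\cup\{a\},S,A,S)$; $r_2=\max_{(a,v)\in (A\times V)\cap T}\delta(A,S\cup\{(a,v)\},A,S)/c_{(a,v)}$; $r_3=\max_{a\in U,\,(a,v)\in(\{a\}\times V)\cap T}\delta(A\cup\{a\},S\cup\{(a,v)\},A,S)/(1+c_{(a,v)})$. Take a maximizer for the largest of $r_1,r_2,r_3$ and add the corresponding node, edge, or node and edge to $(A,S)$ if the resulting cost is at most $k$; otherwise leave $(A,S)$ unchanged. In case $r_1$ the node is removed from $U$ whether or not it was added; in case $r_2$ the edge is removed from $T$ whether or not it was added; in case $r_3$ the edge is removed from $T$ in any case and the node is removed from $U$ only if it was added. Enumeration Algorithm with parameter $M$: (i) let $(A_1,S_1)$ be a feasible solution maximizing $\sigma$ among those with $|A|+|S|<M$ and $c(A,S)\le k$; (ii) for each $A\subseteq V$, $S\subseteq (A\times V)\setminus E$ with $|A|+|S|=M$ and $c(A,S)\le k$, complete $(A,S)$ by the greedy phase started from $(A,S)$ with $U=V\setminus A$ and $T=((V\times V)\setminus E)\setminus S$, and let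 $(A_2,S_2)$ be the completed solution of largest $\sigma$; (iii) return the one of $(A_1,S_1)$, $(A_2,S_2)$ with larger $\sigma$. *)

theory Defs
  imports "HOL-Probability.Probability"
begin

type_synonym 'v edge = "'v \<times> 'v"

text \<open>
  \<open>prop_prob\<close> and \<open>edge_cost\<close> are total functions on pairs, but only their values on
  \<open>nodes \<times> nodes\<close> matter. A solution is a pair \<open>(A, S)\<close> of a seed set and a set of added edges.
\<close>

record 'v instance_graph =
  nodes :: "'v set"
  edges :: "'v edge set"
  prop_prob :: "'v edge \<Rightarrow> real"
  edge_cost :: "'v edge \<Rightarrow> real"

type_synonym 'v solution = "'v set \<times> 'v edge set"

definition valid_instance :: "'v instance_graph \<Rightarrow> bool" where
  "valid_instance G \<longleftrightarrow>
     finite (nodes G) \<and>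
     edges G \<subseteq> nodes G \<times> nodes G \<and>
     (\<forall>e \<in> nodes G \<times> nodes G. 0 \<le> prop_prob G e \<and> prop_prob G e \<le> 1) \<and>
     (\<forall>e \<in> nodes G \<times> nodes G. 0 \<le> edge_cost G e \<and> edge_cost G e \<le> 1)"


section \<open>Independent cascade with added edges\<close>

text \<open>A live-edge graph is identified with its set of edges.\<close>

definition live_edge_pmf :: "'v instance_graph \<Rightarrow> 'v edge set \<Rightarrow> 'v edge set pmf" where
  "live_edge_pmf G S =
     map_pmf Collect (Pi_pmf (edges G \<union> S) False (\<lambda>e. bernoulli_pmf (prop_prob G e)))"

definition live_edge_graphs :: "'v instance_graph \<Rightarrow> 'v edge set \<Rightarrow> 'v edge set set" where
  "live_edge_graphs G S = Pow (edges G \<union> S)"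

lemma pmf_live_edge_pmf:
  assumes "finite (edges G \<union> S)" and "X \<in> live_edge_graphs G S"
    and "\<forall>e \<in> edges G \<union> S. 0 \<le> prop_prob G e \<and> prop_prob G e \<le> 1"
  shows "pmf (live_edge_pmf G S) X =
           (\<Prod>e\<in>X. prop_prob G e) * (\<Prod>e\<in>(edges G \<union> S) - X. 1 - prop_prob G e)"
proof -
  let ?F = "edges G \<union> S"
  let ?b = "\<lambda>e. bernoulli_pmf (prop_prob G e)"
  have X: "X \<subseteq> ?F" using assms(2) by (simp add: live_edge_graphs_def)
  have "pmf (live_edge_pmf G S) (Collect (\<lambda>e. e \<in> X)) = pmf (Pi_pmf ?F False ?b) (\<lambda>e. e \<in> X)"
    unfolding live_edge_pmf_def by (rule pmf_map_inj') (auto simp: inj_def)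
  also have "\<dots> = (\<Prod>e\<in>?F. pmf (?b e) (e \<in> X))"
    using assms(1) X by (intro pmf_Pi') auto
  also have "\<dots> = (\<Prod>e\<in>?F - X. pmf (?b e) (e \<in> X)) * (\<Prod>e\<in>X. pmf (?b e) (e \<in> X))"
    by (rule prod.subset_diff[OF X assms(1)])
  also have "(\<Prod>e\<in>?F - X. pmf (?b e) (e \<in> X)) = (\<Prod>e\<in>?F - X. 1 - prop_prob G e)"
    using assms(3) by (intro prod.cong) auto
  also have "(\<Prod>e\<in>X. pmf (?b e) (e \<in> X)) = (\<Prod>e\<in>X. prop_prob G e)"
    using assms(3) X by (intro prod.cong) auto
  finally show ?thesis by (simp add: mult.commute)
qed

definition reachable :: "'v set \<Rightarrow> 'v edge set \<Rightarrow> 'v set" where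
  "reachable A X = X\<^sup>* `` A"

definition spread :: "'v instance_graph \<Rightarrow> 'v solution \<Rightarrow> real" where
  "spread G = (\<lambda>(A, S).
     \<Sum>X\<in>live_edge_graphs G S. pmf (live_edge_pmf G S) X * real (card (reachable A X)))"

definition spread_gain ::
    "'v instance_graph \<Rightarrow> 'v set \<Rightarrow> 'v edge set \<Rightarrow> 'v set \<Rightarrow> 'v edge set \<Rightarrow> real" where
  "spread_gain G A\<^sub>1 S\<^sub>1 A\<^sub>2 S\<^sub>2 =
     (\<Sum>X\<in>live_edge_graphs G S\<^sub>1. pmf (live_edge_pmf G S\<^sub>1) X *
        (real (card (reachable A\<^sub>1 X)) - real (card (reachable A\<^sub>2 (X - (S\<^sub>1 - S\<^sub>2))))))"


section \<open>Budgeted influence maximization with augmentation\<close>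

definition total_cost :: "'v instance_graph \<Rightarrow> 'v solution \<Rightarrow> real" where
  "total_cost G = (\<lambda>(A, S). real (card A) + (\<Sum>e\<in>S. edge_cost G e))"

definition feasible :: "'v instance_graph \<Rightarrow> nat \<Rightarrow> 'v solution set" where
  "feasible G k = {(A, S). A \<subseteq> nodes G \<and> S \<subseteq> (A \<times> nodes G) - edges G \<and>
                           total_cost G (A, S) \<le> real k}"

definition optimal :: "'v instance_graph \<Rightarrow> nat \<Rightarrow> 'v solution \<Rightarrow> bool" where
  "optimal G k sol \<longleftrightarrow> is_arg_max (spread G) (\<lambda>s. s \<in> feasible G k) sol"


section \<open>Greedy phase\<close>

text \<open>
  A state \<open>(A, S, U, T)\<close> consists of the current solution, the available nodes and the available
  edges. \<open>Add_Both (a, v)\<close> adds the node \<open>a\<close> together with the edge \<open>(a, v)\<close>.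
\<close>

type_synonym 'v state = "'v set \<times> 'v edge set \<times> 'v set \<times> 'v edge set"

datatype 'v move = Add_Node 'v | Add_Edge "'v edge" | Add_Both "'v edge"

definition moves :: "'v instance_graph \<Rightarrow> 'v state \<Rightarrow> 'v move set" where
  "moves G = (\<lambda>(A, S, U, T).
     Add_Node ` U \<union>
     Add_Edge ` ((A \<times> nodes G) \<inter> T) \<union>
     Add_Both ` ((U \<times> nodes G) \<inter> T))"

fun ratio :: "'v instance_graph \<Rightarrow> 'v set \<Rightarrow> 'v edge set \<Rightarrow> 'v move \<Rightarrow> real" where
  "ratio G A S (Add_Node a) = spread_gain G (A \<union> {a}) S A S"
| "ratio G A S (Add_Edge e) = spread_gain G A (S \<union> {e}) A S / edge_cost G e"
| "ratio G A S (Add_Both e) =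
     spread_gain G (A \<union> {fst e}) (S \<union> {e}) A S / (1 + edge_cost G e)"

text \<open>
  A maximizer of the largest of the three maxima is a maximizer over all moves together; a maximum
  over an empty set of candidates is thereby ignored. Ties are broken arbitrarily.
\<close>

definition best_move :: "'v instance_graph \<Rightarrow> 'v state \<Rightarrow> 'v move \<Rightarrow> bool" where
  "best_move G = (\<lambda>(A, S, U, T). is_arg_max (ratio G A S) (\<lambda>m. m \<in> moves G (A, S, U, T)))"

inductive greedy_step :: "'v instance_graph \<Rightarrow> nat \<Rightarrow> 'v state \<Rightarrow> 'v state \<Rightarrow> bool"
  for G :: "'v instance_graph" and k :: nat where
  add_node: "best_move G (A, S, U, T) (Add_Node a) \<Longrightarrow>
     greedy_step G k (A, S, U, T)
       (if total_cost G (A \<union> {a}, S) \<le> real k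
        then (A \<union> {a}, S, U - {a}, T)
        else (A, S, U - {a}, T))"
| add_edge: "best_move G (A, S, U, T) (Add_Edge e) \<Longrightarrow>
     greedy_step G k (A, S, U, T)
       (if total_cost G (A, S \<union> {e}) \<le> real k
        then (A, S \<union> {e}, U, T - {e})
        else (A, S, U, T - {e}))"
| add_both: "best_move G (A, S, U, T) (Add_Both (a, v)) \<Longrightarrow>
     greedy_step G k (A, S, U, T)
       (if total_cost G (A \<union> {a}, S \<union> {(a, v)}) \<le> real k
        then (A \<union> {a}, S \<union> {(a, v)}, U - {a}, T - {(a, v)})
        else (A, S, U, T - {(a, v)}))"

text \<open>
  The loop stops when no move is left. This covers \<open>U = {}\<close> and \<open>T = {}\<close>, and also the situation
  \<open>U = {}\<close>, \<open>T \<noteq> {}\<close> where all remaining edges leave discarded nodes: then all three maxima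
  range over empty sets and nothing can change any more.
\<close>

definition greedy_completion ::
    "'v instance_graph \<Rightarrow> nat \<Rightarrow> 'v solution \<Rightarrow> 'v solution \<Rightarrow> bool" where
  "greedy_completion G k = (\<lambda>(A, S) (A', S').
     \<exists>U' T'. (greedy_step G k)\<^sup>*\<^sup>*
               (A, S, nodes G - A, ((nodes G \<times> nodes G) - edges G) - S) (A', S', U', T') \<and>
             moves G (A', S', U', T') = {})"


section \<open>Enumeration algorithm\<close>

definition small_solutions :: "'v instance_graph \<Rightarrow> nat \<Rightarrow> nat \<Rightarrow> 'v solution set" where
  "small_solutions G k M = {(A, S) \<in> feasible G k. card A + card S < M}"

definition start_solutions :: "'v instance_graph \<Rightarrow> nat \<Rightarrow> nat \<Rightarrow> 'v solution set" where
  "start_solutions G k M = {(A, S) \<in> feasible G k. card A + card S = M}"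

text \<open>
  The algorithm is nondeterministic through its tie-breaking: \<open>enumeration_output G k M sol\<close> says
  that \<open>sol\<close> is a possible result. The function \<open>h\<close> records the completion that is computed for
  each start solution. If there is no start solution, the best small solution is returned.
\<close>

definition enumeration_output ::
    "'v instance_graph \<Rightarrow> nat \<Rightarrow> nat \<Rightarrow> 'v solution \<Rightarrow> bool" where
  "enumeration_output G k M sol \<longleftrightarrow>
     (\<exists>sol\<^sub>1 h.
        is_arg_max (spread G) (\<lambda>s. s \<in> small_solutions G k M) sol\<^sub>1 \<and>
        (\<forall>s \<in> start_solutions G k M. greedy_completion G k s (h s)) \<and>
        (if start_solutions G k M = {} then sol = sol\<^sub>1
         else \<exists>sol\<^sub>2. is_arg_max (spread G) (\<lambda>s. s \<in> h ` start_solutions G k M) sol\<^sub>2 \<and>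
                     is_arg_max (spread G) (\<lambda>s. s \<in> {sol\<^sub>1, sol\<^sub>2}) sol))"

end

theory Submission
  imports Defs
begin

section \<open>The spread as a coverage function\<close>

text \<open>
  Vertices and candidate edges together form the ground set \<open>'v + 'v edge\<close>; a solution \<open>(A, S)\<close>
  becomes \<open>A <+> S\<close>. All added edges leave seeds, so an added live edge has the same effect as
  an additional seed at its head.
\<close>

text \<open>For arbitrary added edges the spread is not submodular: an edge may pay off only because
  another added edge leads to its tail. When added edges leave seeds, their tails are active anyway,
  so what an item covers depends on the sample \<open>X\<close> alone and not on the other items.
  This is why reachability is taken in \<open>X \<inter> edges G\<close>, and why the spread is a
  monotone submodular coverage function, defined even for sets in which an edge lacks its source.
  One sample over all pairs serves every solution, so that inequalities can be checked sample by
  sample. The obstacle that remains is that the greedy phase cannot buy an edge without its source.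
  In the greedy estimate this appears as a higher price of the edge, and that is the origin of the
  exponent \<open>c / (1 + c)\<close>, where \<open>c\<close> bounds the edge costs from
  below.\<close>

definition item_cover :: "'v instance_graph \<Rightarrow> 'v edge set \<Rightarrow> 'v + 'v edge \<Rightarrow> 'v set" where
  "item_cover G X z = reachable
     (case z of Inl a \<Rightarrow> {a} | Inr e \<Rightarrow> if e \<in> X then {snd e} else {}) (X \<inter> edges G)"

definition item_spread :: "'v instance_graph \<Rightarrow> ('v + 'v edge) set \<Rightarrow> real" where
  "item_spread G Z =
     (\<Sum>X\<in>Pow (nodes G \<times> nodes G). pmf (live_edge_pmf G (nodes G \<times> nodes G)) X *
        real (card (\<Union>z\<in>Z. item_cover G X z)))"

definition item_cost :: "'v instance_graph \<Rightarrow> 'v + 'v edge \<Rightarrow> real" where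
  "item_cost G z = (case z of Inl a \<Rightarrow> 1 | Inr e \<Rightarrow> edge_cost G e)"

section \<open>Coupling of live-edge graphs of different augmentations\<close>

lemma set_pmf_live_edge_pmf:
  assumes "finite (edges G \<union> S)"
  shows "set_pmf (live_edge_pmf G S) \<subseteq> live_edge_graphs G S"
  using set_Pi_pmf_subset[OF assms, of False "\<lambda>e. bernoulli_pmf (prop_prob G e)"]
  by (fastforce simp: live_edge_pmf_def live_edge_graphs_def)

lemma live_edge_pmf_restrict:
  assumes "finite (edges G \<union> S')" and "S \<subseteq> edges G \<union> S'"
  shows "live_edge_pmf G S = map_pmf (\<lambda>X. X \<inter> (edges G \<union> S)) (live_edge_pmf G S')"
proof -
  have sub: "edges G \<union> S \<subseteq> edges G \<union> S'" using assms(2) by auto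
  show ?thesis
    unfolding live_edge_pmf_def Pi_pmf_subset[OF assms(1) sub] pmf.map_comp
    by (intro map_pmf_cong) auto
qed

text \<open>A live-edge graph for \<open>S\<close> is one for \<open>S'\<close> with all pairs
  outside \<open>edges G \<union> S\<close> forgotten. Sums over different sets of live-edge graphs
  thus become sums over a common one.\<close>

lemma sum_live_edge_restrict:
  fixes \<phi> :: "'v edge set \<Rightarrow> real"
  assumes fin: "finite (edges G \<union> S')" and sub: "S \<subseteq> edges G \<union> S'"
  shows "(\<Sum>X\<in>live_edge_graphs G S. pmf (live_edge_pmf G S) X * \<phi> X) =
         (\<Sum>X\<in>live_edge_graphs G S'. pmf (live_edge_pmf G S') X * \<phi> (X \<inter> (edges G \<union> S)))"
proof -
  have fin': "finite (edges G \<union> S)" using finite_subset[OF _ fin] sub by blast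
  have "(\<Sum>X\<in>live_edge_graphs G S. pmf (live_edge_pmf G S) X * \<phi> X) =
        measure_pmf.expectation (live_edge_pmf G S) \<phi>"
    using set_pmf_live_edge_pmf[OF fin'] fin'
    by (subst integral_measure_pmf_real[where A = "live_edge_graphs G S"])
       (auto simp: mult.commute live_edge_graphs_def)
  also have "\<dots> = measure_pmf.expectation (live_edge_pmf G S') (\<lambda>X. \<phi> (X \<inter> (edges G \<union> S)))"
    by (simp add: live_edge_pmf_restrict[OF fin sub])
  also have "\<dots> = (\<Sum>X\<in>live_edge_graphs G S'.
      pmf (live_edge_pmf G S') X * \<phi> (X \<inter> (edges G \<union> S)))"
    using set_pmf_live_edge_pmf[OF fin] fin
    by (subst integral_measure_pmf_real[where A = "live_edge_graphs G S'"])
       (auto simp: mult.commute live_edge_graphs_def)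
  finally show ?thesis .
qed

text \<open>A path matters only from its last added edge on: the rest starts at the head of that
  edge and stays in \<open>edges G\<close>. Conversely, the source of an added edge belongs to
  \<open>A\<close>, so the head of a live added edge is indeed reached.\<close>

lemma reachable_eq_item_cover:
  assumes S: "S \<subseteq> A \<times> V"
  shows "reachable A (X \<inter> (edges G \<union> S)) = (\<Union>z\<in>A <+> S. item_cover G X z)"
proof (intro equalityI subsetI)
  fix v assume "v \<in> reachable A (X \<inter> (edges G \<union> S))"
  then obtain a where a: "a \<in> A" and "(a, v) \<in> (X \<inter> (edges G \<union> S))\<^sup>*"
    by (auto simp: reachable_def)
  from this(2) show "v \<in> (\<Union>z\<in>A <+> S. item_cover G X z)"
  proof induction
    case base
    then show ?case using a by (force simp: item_cover_def reachable_def)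
  next
    case (step y z)
    show ?case
    proof (cases "(y, z) \<in> S")
      case True
      \<comment> \<open>The path up to \<open>y\<close> is dropped: the edge is live, so its own
        item covers its head.\<close>
      have "z \<in> item_cover G X (Inr (y, z))" using step by (simp add: item_cover_def reachable_def)
      then show ?thesis using True by blast
    next
      case False
      then have "(y, z) \<in> X \<inter> edges G" using step by auto
      then show ?thesis using step.IH
        by (auto simp: item_cover_def reachable_def intro: rtrancl_into_rtrancl)
    qed
  qed
next
  fix v assume "v \<in> (\<Union>z\<in>A <+> S. item_cover G X z)"
  then obtain z where z: "z \<in> A <+> S" and v: "v \<in> item_cover G X z" by blast
  have mono: "(X \<inter> edges G)\<^sup>* \<subseteq> (X \<inter> (edges G \<union> S))\<^sup>*" by (intro rtrancl_mono) auto
  show "v \<in> reachable A (X \<inter> (edges G \<union> S))"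
  proof (cases z)
    case (Inl a)
    then show ?thesis using z v mono by (auto simp: item_cover_def reachable_def)
  next
    case (Inr e)
    then have "e \<in> S" "e \<in> X" "(snd e, v) \<in> (X \<inter> (edges G \<union> S))\<^sup>*"
      using z v mono by (auto simp: item_cover_def reachable_def split: if_splits)
    then have "fst e \<in> A" "(fst e, v) \<in> (X \<inter> (edges G \<union> S))\<^sup>*"
      using S by (auto simp: mem_Times_iff intro: converse_rtrancl_into_rtrancl[of _ "snd e"])
    then show ?thesis by (auto simp: reachable_def)
  qed
qed

lemma item_cover_subset:
  assumes "X \<subseteq> V \<times> V" and "z \<in> V <+> V \<times> V"
  shows "item_cover G X z \<subseteq> V"
proof -
  have "(a, b) \<in> (X \<inter> edges G)\<^sup>* \<Longrightarrow> a \<in> V \<Longrightarrow> b \<in> V" for a b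
    by (induction rule: rtrancl_induct) (use assms(1) in auto)
  then show ?thesis using assms
    by (auto simp: item_cover_def reachable_def split: if_splits)
qed

section \<open>Monotonicity and diminishing returns\<close>

lemma item_spread_empty [simp]: "item_spread G {} = 0"
  by (simp add: item_spread_def)

lemma item_spread_mono:
  assumes "finite (nodes G)" and "Z \<subseteq> Z'" and "Z' \<subseteq> nodes G <+> nodes G \<times> nodes G"
  shows "item_spread G Z \<le> item_spread G Z'"
  unfolding item_spread_def
proof (intro sum_mono mult_left_mono)
  fix X assume "X \<in> Pow (nodes G \<times> nodes G)"
  then have "(\<Union>z\<in>Z'. item_cover G X z) \<subseteq> nodes G"
    using assms(3) item_cover_subset[of X "nodes G"] by blast
  then have "card (\<Union>z\<in>Z. item_cover G X z) \<le> card (\<Union>z\<in>Z'. item_cover G X z)"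
    using assms by (intro card_mono) (auto intro: finite_subset)
  then show "real (card (\<Union>z\<in>Z. item_cover G X z)) \<le> real (card (\<Union>z\<in>Z'. item_cover G X z))"
    by simp
qed auto

text \<open>The gain of \<open>R\<close> over a finite set \<open>B\<close> is
  \<open>card (R - B)\<close>, which shrinks as \<open>B\<close> grows.\<close>

lemma card_union_diminishing:
  assumes "finite Q" and "finite R" and "P \<subseteq> Q"
  shows "real (card (Q \<union> R)) - real (card Q) \<le> real (card (P \<union> R)) - real (card P)"
proof -
  have diff: "real (card (B \<union> R)) - real (card B) = real (card (R - B))" if "finite B" for B
    using card_Un_disjoint[of B "R - B"] that assms(2) by auto
  have "card (R - Q) \<le> card (R - P)" using assms by (intro card_mono) auto
  moreover have "finite P" using assms finite_subset by blast
  ultimately show ?thesis using diff[of P] diff[of Q] assms by simp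
qed

text \<open>Diminishing returns hold in every sample and survive averaging. The increment
  \<open>D\<close> is a set because one greedy move may bring a node together with an edge.\<close>

lemma item_spread_diminishing:
  assumes "finite (nodes G)" and "Z \<subseteq> Z'" and "Z' \<union> D \<subseteq> nodes G <+> nodes G \<times> nodes G"
  shows "item_spread G (Z' \<union> D) - item_spread G Z' \<le> item_spread G (Z \<union> D) - item_spread G Z"
  unfolding item_spread_def sum_subtractf[symmetric] right_diff_distrib[symmetric]
proof (intro sum_mono mult_left_mono)
  fix X assume "X \<in> Pow (nodes G \<times> nodes G)"
  then have "(\<Union>z\<in>Z'. item_cover G X z) \<subseteq> nodes G" "(\<Union>z\<in>D. item_cover G X z) \<subseteq> nodes G"
    using assms(3) item_cover_subset[of X "nodes G"] by blast+
  then have "finite (\<Union>z\<in>Z'. item_cover G X z)" "finite (\<Union>z\<in>D. item_cover G X z)"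
    using assms(1) finite_subset by blast+
  from card_union_diminishing[OF this, of "\<Union>z\<in>Z. item_cover G X z"] assms(2)
  show "real (card (\<Union>z\<in>Z' \<union> D. item_cover G X z)) - real (card (\<Union>z\<in>Z'. item_cover G X z)) \<le>
        real (card (\<Union>z\<in>Z \<union> D. item_cover G X z)) - real (card (\<Union>z\<in>Z. item_cover G X z))"
    unfolding UN_Un by blast
qed auto

text \<open>Telescoping over \<open>D\<close>: each item is worth most when it is added directly to
  \<open>Z\<close>.\<close>

lemma item_spread_union_le:
  assumes "finite (nodes G)" and "Z \<union> D \<subseteq> nodes G <+> nodes G \<times> nodes G"
  shows "item_spread G (Z \<union> D) - item_spread G Z \<le>
         (\<Sum>x\<in>D. item_spread G (insert x Z) - item_spread G Z)"
proof -
  have "finite D" using assms by (auto intro: finite_subset)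
  then show ?thesis using assms(2)
  proof induction
    case (insert x D)
    have "item_spread G (Z \<union> D \<union> {x}) - item_spread G (Z \<union> D) \<le>
          item_spread G (Z \<union> {x}) - item_spread G Z"
      using insert.prems by (intro item_spread_diminishing assms) auto
    with insert show ?case by auto
  qed simp
qed

section \<open>Translation of spread, gain and cost into items\<close>

lemma spread_eq_item_spread:
  assumes "valid_instance G" and "A \<subseteq> nodes G" and "S \<subseteq> A \<times> nodes G"
  shows "spread G (A, S) = item_spread G (A <+> S)"
proof -
  have E: "edges G \<union> nodes G \<times> nodes G = nodes G \<times> nodes G" "finite (nodes G)"
    using assms(1) by (auto simp: valid_instance_def)
  have "S \<subseteq> edges G \<union> nodes G \<times> nodes G" using assms by auto
  then have "spread G (A, S) = (\<Sum>X\<in>live_edge_graphs G (nodes G \<times> nodes G).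
      pmf (live_edge_pmf G (nodes G \<times> nodes G)) X * real (card (reachable A (X \<inter> (edges G \<union> S)))))"
    unfolding spread_def using E by (simp add: sum_live_edge_restrict[of G "nodes G \<times> nodes G" S])
  also have "\<dots> = item_spread G (A <+> S)"
    using reachable_eq_item_cover[OF assms(3), of _ G] E
    by (simp add: item_spread_def live_edge_graphs_def)
  finally show ?thesis .
qed

text \<open>Because \<open>S\<^sub>1\<close> avoids \<open>edges G\<close>, deleting
  \<open>S\<^sub>1 - S\<^sub>2\<close> from a sample is the same as restricting it to
  \<open>edges G \<union> S\<^sub>2\<close>, which is exactly the coupling.\<close>

lemma spread_gain_eq:
  assumes "finite (edges G \<union> S\<^sub>1)" and "S\<^sub>2 \<subseteq> S\<^sub>1" and "S\<^sub>1 \<inter> edges G = {}"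
  shows "spread_gain G A\<^sub>1 S\<^sub>1 A\<^sub>2 S\<^sub>2 = spread G (A\<^sub>1, S\<^sub>1) - spread G (A\<^sub>2, S\<^sub>2)"
proof -
  have "X - (S\<^sub>1 - S\<^sub>2) = X \<inter> (edges G \<union> S\<^sub>2)" if "X \<in> live_edge_graphs G S\<^sub>1" for X
    using that assms by (auto simp: live_edge_graphs_def)
  moreover have "S\<^sub>2 \<subseteq> edges G \<union> S\<^sub>1" using assms(2) by auto
  ultimately show ?thesis using assms(1)
    by (simp add: spread_gain_def spread_def right_diff_distrib sum_subtractf
        sum_live_edge_restrict[of G S\<^sub>1 S\<^sub>2])
qed

lemma total_cost_eq_item_cost:
  assumes "finite A" and "finite S"
  shows "total_cost G (A, S) = sum (item_cost G) (A <+> S)"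
  using assms by (simp add: total_cost_def item_cost_def sum.Plus)


section \<open>Seeds for the enumeration\<close>

lemma ex_is_arg_max_if_finite:
  fixes f :: "'a \<Rightarrow> real"
  assumes "finite P" and "P \<noteq> {}"
  shows "\<exists>x. is_arg_max f (\<lambda>x. x \<in> P) x"
  using ex_is_arg_min_if_finite[OF assms, of "\<lambda>x. - f x"]
  by (simp add: is_arg_min_def is_arg_max_def)

lemma is_arg_max_ge:
  fixes f :: "'a \<Rightarrow> 'b::linorder"
  shows "is_arg_max f P x \<Longrightarrow> P y \<Longrightarrow> f y \<le> f x"
  by (auto simp: is_arg_max_def not_less)

text \<open>\<open>A <+> S\<close> has this property exactly when every edge of \<open>S\<close>
  leaves \<open>A\<close>. In terms of items the condition is visibly preserved by unions.\<close>

definition source_closed :: "('v + 'v edge) set \<Rightarrow> bool" where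
  "source_closed Z \<longleftrightarrow> (\<forall>e. Inr e \<in> Z \<longrightarrow> Inl (fst e) \<in> Z)"

text \<open>A missing node can always be added, and once no node is missing, every missing edge has
  its source present; so growth by one item is always possible. The exact size matters because the
  enumeration starts from exactly \<open>M\<close> items.\<close>

lemma source_closed_extend:
  assumes "source_closed Z" and "finite Z" and "source_closed Y" and "Y \<subseteq> Z"
    and "card Y \<le> m" and "m \<le> card Z"
  obtains Y' where "Y \<subseteq> Y'" and "Y' \<subseteq> Z" and "source_closed Y'" and "card Y' = m"
proof -
  have "\<exists>Y'. Y \<subseteq> Y' \<and> Y' \<subseteq> Z \<and> source_closed Y' \<and> card Y' = m"
    using assms(5,6)
  proof (induction m rule: dec_induct)
    case base
    then show ?case using assms by blast
  next
    case (step m)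
    then obtain Y' where Y': "Y \<subseteq> Y'" "Y' \<subseteq> Z" "source_closed Y'" "card Y' = m" by auto
    have fin: "finite Y'" using Y' assms(2) finite_subset by blast
    have "Y' \<noteq> Z" using Y' step.prems by auto
    then obtain z where z: "z \<in> Z - Y'" using Y'(2) by blast
    have "\<exists>x\<in>Z - Y'. source_closed (insert x Y')"
    proof (cases "\<exists>a. Inl a \<in> Z - Y'")
      case True
      then obtain a where "Inl a \<in> Z - Y'" by blast
      moreover have "source_closed (insert (Inl a) Y')" using Y'(3) by (auto simp: source_closed_def)
      ultimately show ?thesis by blast
    next
      case False
      then obtain e where e: "z = Inr e" using z by (cases z) auto
      then have "Inl (fst e) \<in> Y'" using False z assms(1) unfolding source_closed_def by blast
      then have "source_closed (insert z Y')" using Y'(3) e by (auto simp: source_closed_def)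
      then show ?thesis using z by blast
    qed
    then obtain x where x: "x \<in> Z - Y'" "source_closed (insert x Y')" by blast
    then have "card (insert x Y') = Suc m" using Y' fin by simp
    then show ?case using x Y' by blast
  qed
  then show ?thesis using that by blast
qed

text \<open>
  Two greedy rounds over source-closed increments of size at most two. A later increment is worth
  at most as much as each of the two rounds, hence at most half of the value of the seed; this is
  where \<open>M \<ge> 4\<close> is used.
\<close>

lemma obtain_seed:
  assumes fin: "finite (nodes G)" and Z: "source_closed Z" "Z \<subseteq> nodes G <+> nodes G \<times> nodes G"
    and M: "4 \<le> M" "M \<le> card Z"
  obtains Y where "Y \<subseteq> Z" and "source_closed Y" and "card Y = M"
    and "\<And>D. D \<subseteq> Z \<Longrightarrow> source_closed D \<Longrightarrow> card D \<le> 2 \<Longrightarrow>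
           2 * (item_spread G (Y \<union> D) - item_spread G Y) \<le> item_spread G Y"
proof -
  let ?F = "item_spread G"
  define P where "P = {D. D \<subseteq> Z \<and> source_closed D \<and> card D \<le> 2}"
  have finZ: "finite Z" using Z fin by (auto intro: finite_subset)
  then have P: "finite P" "P \<noteq> {}" by (auto simp: P_def source_closed_def)
  obtain Y1 where Y1: "is_arg_max ?F (\<lambda>D. D \<in> P) Y1"
    using ex_is_arg_max_if_finite[OF P] by blast
  obtain D2 where D2: "is_arg_max (\<lambda>D. ?F (Y1 \<union> D)) (\<lambda>D. D \<in> P) D2"
    using ex_is_arg_max_if_finite[OF P] by blast
  have in_P: "Y1 \<in> P" "D2 \<in> P" using Y1 D2 by (auto simp: is_arg_max_def)
  then have "card (Y1 \<union> D2) \<le> M" using M card_Un_le[of Y1 D2] by (auto simp: P_def)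
  moreover have "source_closed (Y1 \<union> D2)" "Y1 \<union> D2 \<subseteq> Z"
    using in_P by (auto simp: P_def source_closed_def)
  ultimately obtain Y where Y: "Y1 \<union> D2 \<subseteq> Y" "Y \<subseteq> Z" "source_closed Y" "card Y = M"
    using source_closed_extend[OF Z(1) finZ] M by metis
  show ?thesis
  proof (rule that[OF Y(2,3,4)])
    fix D assume D: "D \<subseteq> Z" "source_closed D" "card D \<le> 2"
    then have "D \<in> P" by (simp add: P_def)
    then have "?F D \<le> ?F Y1" "?F (Y1 \<union> D) \<le> ?F (Y1 \<union> D2)"
      using is_arg_max_ge[OF Y1] is_arg_max_ge[OF D2] by auto
    moreover have "?F (Y1 \<union> D2) \<le> ?F Y"
      using Y Z by (intro item_spread_mono fin) auto
    moreover have "?F (Y \<union> D) - ?F Y \<le> ?F (Y1 \<union> D) - ?F Y1"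
      using Y Z D by (intro item_spread_diminishing fin) auto
    moreover have "?F (Y \<union> D) - ?F Y \<le> ?F ({} \<union> D) - ?F {}"
      using Y Z D by (intro item_spread_diminishing fin) auto
    \<comment> \<open>The gain is at most \<open>?F Y1\<close> and at most
      \<open>?F (Y1 \<union> D2) - ?F Y1\<close>; in the sum of the two bounds \<open>?F Y1\<close>
      cancels.\<close>
    ultimately show "2 * (?F (Y \<union> D) - ?F Y) \<le> ?F Y" by simp
  qed
qed


section \<open>Analysis of the greedy phase\<close>

text \<open>
  For \<open>Add_Edge e\<close> the source of \<open>e\<close> is already a seed, so including it among the items changes
  neither the solution nor its cost, but makes the set of items source-closed.
\<close>

fun move_items :: "'v move \<Rightarrow> ('v + 'v edge) set" where
  "move_items (Add_Node a) = {Inl a}"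
| "move_items (Add_Edge e) = {Inl (fst e), Inr e}"
| "move_items (Add_Both e) = {Inl (fst e), Inr e}"

text \<open>The item that becomes unavailable when the move is rejected.\<close>

fun move_pivot :: "'v move \<Rightarrow> 'v + 'v edge" where
  "move_pivot (Add_Node a) = Inl a"
| "move_pivot (Add_Edge e) = Inr e"
| "move_pivot (Add_Both e) = Inr e"

lemma source_closed_move_items: "source_closed (move_items m)"
  by (cases m) (auto simp: source_closed_def)

lemma card_move_items_le: "card (move_items m) \<le> 2"
  by (cases m) (auto simp: card_insert_if)

lemma move_items_subset: "source_closed Z \<Longrightarrow> move_pivot m \<in> Z \<Longrightarrow> move_items m \<subseteq> Z"
  by (cases m) (auto simp: source_closed_def)

text \<open>Invariant of the greedy phase. Available items are disjoint from the solution, so with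
  positive prices every move strictly raises the cost and no ratio divides by zero. Available edges
  avoid \<open>edges G\<close>, so that \<open>spread_gain\<close> is a difference of
  spreads.\<close>

definition wf_state :: "'v instance_graph \<Rightarrow> nat \<Rightarrow> 'v state \<Rightarrow> bool" where
  "wf_state G k = (\<lambda>(A, S, U, T). (A, S) \<in> feasible G k \<and> U \<subseteq> nodes G - A \<and>
     T \<subseteq> (nodes G \<times> nodes G - edges G) - S)"

locale augmentation_instance =
  fixes G :: "'v instance_graph" and c :: real
  assumes valid: "valid_instance G" and c_pos: "0 < c"
    and c_le: "\<And>e. e \<in> nodes G \<times> nodes G \<Longrightarrow> c \<le> edge_cost G e"
begin

abbreviation ground :: "('v + 'v edge) set" where
  "ground \<equiv> nodes G <+> nodes G \<times> nodes G"

abbreviation cost :: "('v + 'v edge) set \<Rightarrow> real" where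
  "cost \<equiv> sum (item_cost G)"

text \<open>The largest value of \<open>(1 + x) / x\<close> for \<open>x \<ge> c\<close>, that is,
  the worst overhead of paying for the source along with an edge. Its reciprocal is the exponent in
  the theorem.\<close>

definition slack :: real where
  "slack = (1 + c) / c"

lemma finite_nodes: "finite (nodes G)"
  using valid by (simp add: valid_instance_def)

lemma finite_ground: "finite ground"
  using finite_nodes by simp

lemma finite_edges: "finite (edges G)"
  using valid finite_nodes finite_subset[of "edges G" "nodes G \<times> nodes G"]
  by (auto simp: valid_instance_def)

lemma item_cost_pos: "z \<in> ground \<Longrightarrow> 0 < item_cost G z"
  using c_le c_pos by (fastforce simp: item_cost_def)

lemma slack_ge_1: "1 \<le> slack"
  using c_pos by (simp add: slack_def)

lemma cost_mono: "Z \<subseteq> Z' \<Longrightarrow> Z' \<subseteq> ground \<Longrightarrow> cost Z \<le> cost Z'"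
  by (intro sum_mono2 less_imp_le[OF item_cost_pos] finite_subset[OF _ finite_ground]) blast+

lemma feasibleD:
  assumes "(A, S) \<in> feasible G k"
  shows "A <+> S \<subseteq> ground" and "source_closed (A <+> S)" and "cost (A <+> S) \<le> k"
    and "spread G (A, S) = item_spread G (A <+> S)"
    and "finite A" and "finite S"
proof -
  show fin: "finite A" "finite S"
    using assms finite_nodes finite_subset[of A "nodes G"]
    by (auto simp: feasible_def intro!: finite_subset[of S "nodes G \<times> nodes G"])
  show "cost (A <+> S) \<le> k"
    using assms total_cost_eq_item_cost[OF fin, of G] by (simp add: feasible_def)
  show "spread G (A, S) = item_spread G (A <+> S)"
    using assms by (intro spread_eq_item_spread valid) (auto simp: feasible_def)
qed (use assms in \<open>auto simp: feasible_def source_closed_def\<close>)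

lemma spread_gain_eq_item_spread:
  assumes "A\<^sub>1 \<subseteq> nodes G" and "S\<^sub>1 \<subseteq> A\<^sub>1 \<times> nodes G - edges G"
    and "A\<^sub>2 \<subseteq> A\<^sub>1" and "S\<^sub>2 \<subseteq> S\<^sub>1" and "S\<^sub>2 \<subseteq> A\<^sub>2 \<times> nodes G"
  shows "spread_gain G A\<^sub>1 S\<^sub>1 A\<^sub>2 S\<^sub>2 = item_spread G (A\<^sub>1 <+> S\<^sub>1) - item_spread G (A\<^sub>2 <+> S\<^sub>2)"
proof -
  have "finite (edges G \<union> S\<^sub>1)"
    using finite_edges finite_nodes assms(1,2)
    by (auto intro!: finite_subset[of S\<^sub>1 "nodes G \<times> nodes G"])
  then have "spread_gain G A\<^sub>1 S\<^sub>1 A\<^sub>2 S\<^sub>2 = spread G (A\<^sub>1, S\<^sub>1) - spread G (A\<^sub>2, S\<^sub>2)"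
    using assms by (intro spread_gain_eq) auto
  moreover have "spread G (A\<^sub>1, S\<^sub>1) = item_spread G (A\<^sub>1 <+> S\<^sub>1)"
    using assms by (intro spread_eq_item_spread valid) auto
  moreover have "spread G (A\<^sub>2, S\<^sub>2) = item_spread G (A\<^sub>2 <+> S\<^sub>2)"
    using assms by (intro spread_eq_item_spread valid) auto
  ultimately show ?thesis by simp
qed

section \<open>Greedy moves as increments of item sets\<close>

lemma move_items_ground:
  assumes "wf_state G k (A, S, U, T)" and "m \<in> moves G (A, S, U, T)"
  shows "move_items m \<subseteq> ground"
  using assms by (auto simp: wf_state_def moves_def feasible_def)

text \<open>All three kinds of ratio are the same marginal gain per marginal cost, so the decay
  estimate can treat the moves alike. The strict inequality makes the denominator positive.\<close>

lemma ratio_eq: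
  assumes wf: "wf_state G k (A, S, U, T)" and m: "m \<in> moves G (A, S, U, T)"
  shows "ratio G A S m = (item_spread G ((A <+> S) \<union> move_items m) - item_spread G (A <+> S)) /
           (cost ((A <+> S) \<union> move_items m) - cost (A <+> S))" (is ?eq)
    and "cost (A <+> S) < cost ((A <+> S) \<union> move_items m)" (is ?less)
proof -
  have feas: "(A, S) \<in> feasible G k" and U: "U \<subseteq> nodes G - A"
    and T: "T \<subseteq> (nodes G \<times> nodes G - edges G) - S"
    using wf by (auto simp: wf_state_def)
  have AS: "A \<subseteq> nodes G" "S \<subseteq> A \<times> nodes G - edges G" using feas by (auto simp: feasible_def)
  have fin: "finite A" "finite S" using feasibleD[OF feas] by auto
  have "?eq \<and> ?less"
  proof (cases m)
    case (Add_Node a)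
    then have a: "a \<in> U" using m by (auto simp: moves_def)
    have items: "(A <+> S) \<union> move_items m = (A \<union> {a}) <+> S" using Add_Node by auto
    have "spread_gain G (A \<union> {a}) S A S = item_spread G ((A \<union> {a}) <+> S) - item_spread G (A <+> S)"
      using a U AS by (intro spread_gain_eq_item_spread) auto
    moreover have "cost ((A \<union> {a}) <+> S) = cost (A <+> S) + 1"
      using a U fin by (subst (1 2) sum.Plus) (auto simp: item_cost_def)
    ultimately show ?thesis unfolding items using Add_Node by simp
  next
    case (Add_Edge e)
    then have e: "e \<in> T" "fst e \<in> A" using m by (auto simp: moves_def)
    have items: "(A <+> S) \<union> move_items m = A <+> (S \<union> {e})" using Add_Edge e by auto
    have "spread_gain G A (S \<union> {e}) A S = item_spread G (A <+> (S \<union> {e})) - item_spread G (A <+> S)"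
      using e T AS by (intro spread_gain_eq_item_spread) (auto simp: mem_Times_iff)
    moreover have "cost (A <+> (S \<union> {e})) = cost (A <+> S) + edge_cost G e"
      using e T fin by (subst (1 2) sum.Plus) (auto simp: item_cost_def)
    moreover have "0 < edge_cost G e" using c_le[of e] c_pos e T by fastforce
    ultimately show ?thesis unfolding items using Add_Edge by simp
  next
    case (Add_Both e)
    then have e: "e \<in> T" "fst e \<in> U" using m by (auto simp: moves_def)
    have items: "(A <+> S) \<union> move_items m = (A \<union> {fst e}) <+> (S \<union> {e})" using Add_Both by auto
    have "spread_gain G (A \<union> {fst e}) (S \<union> {e}) A S =
          item_spread G ((A \<union> {fst e}) <+> (S \<union> {e})) - item_spread G (A <+> S)"
      using e T U AS by (intro spread_gain_eq_item_spread) (auto simp: mem_Times_iff)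
    moreover have "cost ((A \<union> {fst e}) <+> (S \<union> {e})) = cost (A <+> S) + (1 + edge_cost G e)"
    proof -
      have "fst e \<notin> A" "e \<notin> S" using e T U by auto
      then show ?thesis using fin by (subst (1 2) sum.Plus) (auto simp: item_cost_def)
    qed
    moreover have "0 < edge_cost G e" using c_le[of e] c_pos e T by fastforce
    ultimately show ?thesis unfolding items using Add_Both by simp
  qed
  then show ?eq ?less by auto
qed

lemma ratio_nonneg:
  assumes "wf_state G k (A, S, U, T)" and "m \<in> moves G (A, S, U, T)"
  shows "0 \<le> ratio G A S m"
proof -
  have "(A, S) \<in> feasible G k" using assms(1) by (simp add: wf_state_def)
  from feasibleD(1)[OF this]
  have "item_spread G (A <+> S) \<le> item_spread G ((A <+> S) \<union> move_items m)"
    using move_items_ground[OF assms] by (intro item_spread_mono finite_nodes) auto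
  then show ?thesis using ratio_eq[OF assms] by simp
qed

text \<open>Condenses the six outcomes of a step. An acceptance loses no item. A rejection loses
  only the pivot; for \<open>Add_Both\<close> this is the edge, while its source stays available.
  The falling cardinality serves termination.\<close>

lemma greedy_step_cases:
  assumes step: "greedy_step G k (A, S, U, T) (A', S', U', T')"
    and wf: "wf_state G k (A, S, U, T)"
  obtains (accept) m where "best_move G (A, S, U, T) m" and "wf_state G k (A', S', U', T')"
      and "A' <+> S' = (A <+> S) \<union> move_items m"
      and "(A <+> S) \<union> (U <+> T) \<subseteq> (A' <+> S') \<union> (U' <+> T')"
      and "card U' + card T' < card U + card T"
  | (reject) m where "best_move G (A, S, U, T) m" and "wf_state G k (A', S', U', T')"
      and "A' <+> S' = A <+> S" and "real k < cost ((A <+> S) \<union> move_items m)"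
      and "U <+> T \<subseteq> insert (move_pivot m) (U' <+> T')" and "move_pivot m \<in> U <+> T"
      and "card U' + card T' < card U + card T"
proof -
  have feas: "(A, S) \<in> feasible G k" and U: "U \<subseteq> nodes G - A"
    and T: "T \<subseteq> (nodes G \<times> nodes G - edges G) - S"
    using wf by (auto simp: wf_state_def)
  have AS: "A \<subseteq> nodes G" "S \<subseteq> A \<times> nodes G - edges G" using feas by (auto simp: feasible_def)
  have fin: "finite A" "finite S" using feasibleD[OF feas] by auto
  have finU: "finite U" using U finite_nodes finite_subset by blast
  have finT: "finite T" using T finite_nodes finite_subset[of T "nodes G \<times> nodes G"] by auto
  have mem: "best_move G (A, S, U, T) m \<Longrightarrow> m \<in> moves G (A, S, U, T)" for m
    by (auto simp: best_move_def is_arg_max_def)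
  from step show ?thesis
  proof cases
    case (add_node a)
    have a: "a \<in> U" using mem[OF add_node(2)] by (auto simp: moves_def)
    have items: "(A <+> S) \<union> move_items (Add_Node a) = (A \<union> {a}) <+> S" by auto
    have card: "card (U - {a}) < card U" using a finU by (rule card_Diff1_less[rotated])
    have tc: "total_cost G (A \<union> {a}, S) = cost ((A <+> S) \<union> move_items (Add_Node a))"
      unfolding items using fin by (intro total_cost_eq_item_cost) auto
    show ?thesis
    proof (cases "total_cost G (A \<union> {a}, S) \<le> real k")
      case True
      then have eq: "A' = A \<union> {a}" "S' = S" "U' = U - {a}" "T' = T" using add_node by auto
      show ?thesis
      proof (rule accept[OF add_node(2)])
        show "wf_state G k (A', S', U', T')"
          using True U T AS a unfolding eq wf_state_def feasible_def by auto
      qed (use eq card in auto)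
    next
      case False
      then have eq: "A' = A" "S' = S" "U' = U - {a}" "T' = T" using add_node by auto
      show ?thesis
        by (rule reject[OF add_node(2)]) (use False tc eq card wf a in \<open>auto simp: wf_state_def\<close>)
    qed
  next
    case (add_edge e)
    have e: "e \<in> T" "fst e \<in> A" using mem[OF add_edge(2)] by (auto simp: moves_def)
    have items: "(A <+> S) \<union> move_items (Add_Edge e) = A <+> (S \<union> {e})" using e by auto
    have card: "card (T - {e}) < card T" using e finT by (intro card_Diff1_less) auto
    have tc: "total_cost G (A, S \<union> {e}) = cost ((A <+> S) \<union> move_items (Add_Edge e))"
      unfolding items using fin by (intro total_cost_eq_item_cost) auto
    show ?thesis
    proof (cases "total_cost G (A, S \<union> {e}) \<le> real k")
      case True
      then have eq: "A' = A" "S' = S \<union> {e}" "U' = U" "T' = T - {e}" using add_edge by auto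
      show ?thesis
      proof (rule accept[OF add_edge(2)])
        show "wf_state G k (A', S', U', T')"
          using True U T AS e unfolding eq wf_state_def feasible_def by (auto simp: mem_Times_iff)
      qed (use eq card e in auto)
    next
      case False
      then have eq: "A' = A" "S' = S" "U' = U" "T' = T - {e}" using add_edge by auto
      show ?thesis
        by (rule reject[OF add_edge(2)]) (use False tc eq card wf e in \<open>auto simp: wf_state_def\<close>)
    qed
  next
    case (add_both a v)
    have e: "(a, v) \<in> T" "a \<in> U" using mem[OF add_both(2)] by (auto simp: moves_def)
    have items: "(A <+> S) \<union> move_items (Add_Both (a, v)) = (A \<union> {a}) <+> (S \<union> {(a, v)})" by auto
    have card: "card (T - {(a, v)}) < card T" "card (U - {a}) < card U"
      using e finT finU by (auto intro!: card_Diff1_less simp del: card_Diff_insert)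
    have tc: "total_cost G (A \<union> {a}, S \<union> {(a, v)}) =
        cost ((A <+> S) \<union> move_items (Add_Both (a, v)))"
      unfolding items using fin by (intro total_cost_eq_item_cost) auto
    show ?thesis
    proof (cases "total_cost G (A \<union> {a}, S \<union> {(a, v)}) \<le> real k")
      case True
      then have eq: "A' = A \<union> {a}" "S' = S \<union> {(a, v)}" "U' = U - {a}" "T' = T - {(a, v)}"
        using add_both by auto
      show ?thesis
      proof (rule accept[OF add_both(2)])
        show "wf_state G k (A', S', U', T')"
          using True U T AS e unfolding eq wf_state_def feasible_def by auto
      qed (use eq card in auto)
    next
      case False
      then have eq: "A' = A" "S' = S" "U' = U" "T' = T - {(a, v)}" using add_both by auto
      show ?thesis
        by (rule reject[OF add_both(2)]) (use False tc eq card wf e in \<open>auto simp: wf_state_def\<close>)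
    qed
  qed
qed

text \<open>
  An edge of the optimum whose source is not yet a seed has to be bought together with its
  source; since \<open>1 + c\<^sub>e \<le> slack * c\<^sub>e\<close>, this costs at most a factor \<open>slack\<close>.
\<close>

lemma gap_le_ratio:
  assumes wf: "wf_state G k (A, S, U, T)" and best: "best_move G (A, S, U, T) m"
    and Zs: "source_closed Zs" "Zs \<subseteq> (A <+> S) \<union> (U <+> T)"
  shows "item_spread G Zs - item_spread G (A <+> S) \<le>
           slack * ratio G A S m * cost (Zs - (A <+> S))"
proof -
  let ?F = "item_spread G" and ?Z = "A <+> S" and ?\<rho> = "ratio G A S m"
  have feas: "(A, S) \<in> feasible G k" and U: "U \<subseteq> nodes G - A"
    and T: "T \<subseteq> (nodes G \<times> nodes G - edges G) - S"
    using wf by (auto simp: wf_state_def)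
  have Z: "?Z \<subseteq> ground" using feasibleD[OF feas] by auto
  have avail: "U <+> T \<subseteq> ground" using U T by auto
  have mem: "m \<in> moves G (A, S, U, T)" using best by (auto simp: best_move_def is_arg_max_def)
  have \<rho>: "0 \<le> ?\<rho>" by (rule ratio_nonneg[OF wf mem])
  have gain: "?F (?Z \<union> move_items m') - ?F ?Z \<le> ?\<rho> * (cost (?Z \<union> move_items m') - cost ?Z)"
    if m': "m' \<in> moves G (A, S, U, T)" for m'
  proof -
    have "ratio G A S m' \<le> ?\<rho>"
      using best m' is_arg_max_ge[of "ratio G A S"] by (force simp: best_move_def)
    then show ?thesis using ratio_eq[OF wf m'] by (simp add: pos_divide_le_eq)
  qed
  \<comment> \<open>Each missing item \<open>x\<close> is charged to an available move that contains
    it and costs at most \<open>slack\<close> times the price of \<open>x\<close>; maximality of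
    \<open>m\<close> then bounds the worth of that move.\<close>
  have item: "?F (insert x ?Z) - ?F ?Z \<le> slack * ?\<rho> * item_cost G x" if x: "x \<in> Zs - ?Z" for x
  proof -
    obtain m' where m': "m' \<in> moves G (A, S, U, T)" "x \<in> move_items m'"
      and le: "cost (?Z \<union> move_items m') - cost ?Z \<le> slack * item_cost G x"
    proof (cases x)
      case (Inl a)
      then have "a \<in> U" using x Zs by auto
      moreover have "cost (?Z \<union> {Inl a}) = cost ?Z + 1"
        using x Inl finite_subset[OF Z finite_ground] by (auto simp: item_cost_def)
      ultimately show ?thesis using that[of "Add_Node a"] Inl slack_ge_1
        by (auto simp: moves_def item_cost_def)
    next
      case (Inr e)
      then have e: "e \<in> T" using x Zs by auto
      then have ce: "c \<le> edge_cost G e" using c_le T by auto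
      have eq: "cost (insert (Inr e) B) = cost B + edge_cost G e" if "Inr e \<notin> B" "B \<subseteq> ground" for B
        using that finite_subset[OF _ finite_ground] by (auto simp: item_cost_def)
      show ?thesis
      proof (cases "fst e \<in> A")
        case True
        have "?Z \<union> {Inl (fst e), Inr e} = insert (Inr e) ?Z" using True by auto
        then have "cost (?Z \<union> move_items (Add_Edge e)) - cost ?Z = edge_cost G e"
          using eq[of ?Z] x Inr Z by simp
        also have "\<dots> \<le> slack * edge_cost G e"
          using slack_ge_1 ce c_pos mult_right_mono[of 1 slack "edge_cost G e"] by simp
        finally show ?thesis using that[of "Add_Edge e"] Inr e True T
          by (auto simp: moves_def item_cost_def mem_Times_iff)
      next
        case False
        \<comment> \<open>The source belongs to \<open>Zs\<close> and is not yet a seed, so it must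
          still be available; this makes \<open>Add_Both e\<close> a legal competitor.\<close>
        have "Inl (fst e) \<in> Zs" using x Inr Zs(1) unfolding source_closed_def by blast
        then have U': "fst e \<in> U" using False Zs by auto
        then have sub: "insert (Inl (fst e)) ?Z \<subseteq> ground" using Z U by auto
        have "cost (insert (Inl (fst e)) ?Z) = cost ?Z + 1"
          using False finite_subset[OF Z finite_ground]
          by (subst sum.insert) (auto simp: item_cost_def)
        moreover have "?Z \<union> {Inl (fst e), Inr e} = insert (Inr e) (insert (Inl (fst e)) ?Z)" by auto
        ultimately have "cost (?Z \<union> move_items (Add_Both e)) - cost ?Z = 1 + edge_cost G e"
          using eq[OF _ sub] x Inr by simp
        \<comment> \<open>After clearing the denominator \<open>c\<close>, this is
          \<open>c \<le> edge_cost G e\<close>.\<close>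
        also have "\<dots> \<le> slack * edge_cost G e"
          using ce c_pos by (simp add: slack_def field_simps)
        finally show ?thesis using that[of "Add_Both e"] Inr e U' T
          by (auto simp: moves_def item_cost_def mem_Times_iff)
      qed
    qed
    have "?F (insert x ?Z) \<le> ?F (?Z \<union> move_items m')"
      using m' Z move_items_ground[OF wf m'(1)] by (intro item_spread_mono finite_nodes) auto
    then have "?F (insert x ?Z) - ?F ?Z \<le> ?\<rho> * (cost (?Z \<union> move_items m') - cost ?Z)"
      using gain[OF m'(1)] by simp
    also have "\<dots> \<le> ?\<rho> * (slack * item_cost G x)" using le \<rho> by (intro mult_left_mono)
    finally show ?thesis by (simp add: mult_ac)
  qed
  have "?F Zs \<le> ?F (?Z \<union> (Zs - ?Z))"
    using Zs Z avail by (intro item_spread_mono finite_nodes) auto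
  also have "\<dots> - ?F ?Z \<le> (\<Sum>x\<in>Zs - ?Z. ?F (insert x ?Z) - ?F ?Z)"
    using Zs Z avail by (intro item_spread_union_le finite_nodes) auto
  also have "\<dots> \<le> (\<Sum>x\<in>Zs - ?Z. slack * ?\<rho> * item_cost G x)"
    by (intro sum_mono item)
  finally show ?thesis by (simp add: sum_distrib_left)
qed

text \<open>By \<open>gap_le_ratio\<close>, a move of additional cost \<open>d\<close> closes at
  least the fraction \<open>d / (slack * cost (Zs - Y))\<close> of an open gap, and
  \<open>1 - x \<le> exp (- x)\<close> turns this into exponential decay. Measuring against
  \<open>cost (Zs - Y)\<close> is possible because \<open>Y\<close> is already in the solution. The
  move need not fit the budget, so the bound also covers rejected moves.\<close>

lemma gap_step:
  assumes wf: "wf_state G k (A, S, U, T)" and best: "best_move G (A, S, U, T) m"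
    and Zs: "source_closed Zs" "Zs \<subseteq> (A <+> S) \<union> (U <+> T)"
    and Y: "Y \<subseteq> A <+> S" "item_spread G Y \<le> item_spread G Zs"
    and gap: "item_spread G Zs - item_spread G (A <+> S) \<le> (item_spread G Zs - item_spread G Y) *
        exp (- (cost (A <+> S) - cost Y) / (slack * cost (Zs - Y)))"
  shows "item_spread G Zs - item_spread G ((A <+> S) \<union> move_items m) \<le>
      (item_spread G Zs - item_spread G Y) *
        exp (- (cost ((A <+> S) \<union> move_items m) - cost Y) / (slack * cost (Zs - Y)))"
proof -
  let ?F = "item_spread G" and ?Z = "A <+> S" and ?Z' = "(A <+> S) \<union> move_items m"
    and ?\<rho> = "ratio G A S m" and ?N = "slack * cost (Zs - Y)"
  define d where "d = cost ?Z' - cost ?Z"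
  have feas: "(A, S) \<in> feasible G k" and avail: "U <+> T \<subseteq> ground"
    using wf by (auto simp: wf_state_def)
  have Z: "?Z \<subseteq> ground" using feasibleD[OF feas] by auto
  have mem: "m \<in> moves G (A, S, U, T)" using best by (auto simp: best_move_def is_arg_max_def)
  have \<rho>: "0 \<le> ?\<rho>" by (rule ratio_nonneg[OF wf mem])
  have d: "0 < d" and gain: "?F ?Z' - ?F ?Z = ?\<rho> * d"
    using ratio_eq[OF wf mem] by (auto simp: d_def)
  have "Zs \<subseteq> ground" using Zs(2) Z avail by blast
  then have "cost (Zs - ?Z) \<le> cost (Zs - Y)" using Y(1) by (intro cost_mono) blast+
  then have "slack * ?\<rho> * cost (Zs - ?Z) \<le> slack * ?\<rho> * cost (Zs - Y)"
    using \<rho> slack_ge_1 by (intro mult_left_mono mult_nonneg_nonneg) linarith+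
  then have le: "?F Zs - ?F ?Z \<le> ?\<rho> * ?N"
    using gap_le_ratio[OF wf best Zs] by (simp add: mult_ac)
  show ?thesis
  proof (cases "?F Zs - ?F ?Z \<le> 0")
    case True
    have "0 \<le> ?\<rho> * d" using \<rho> d by simp
    then have "?F Zs - ?F ?Z' \<le> 0" using True gain by linarith
    also have "0 \<le> (?F Zs - ?F Y) * exp (- (cost ?Z' - cost Y) / ?N)" using Y by simp
    finally show ?thesis .
  next
    case False
    \<comment> \<open>An open gap excludes \<open>?N = 0\<close>, so the divisions by
      \<open>?N\<close> below are genuine.\<close>
    then have "0 < ?\<rho> * ?N" using le by linarith
    then have N: "0 < ?N" using \<rho> by (metis less_le_not_le zero_less_mult_iff)
    have "(?F Zs - ?F ?Z) * (d / ?N) \<le> ?\<rho> * ?N * (d / ?N)"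
      using le by (intro mult_right_mono less_imp_le[OF divide_pos_pos[OF d N]])
    also have "\<dots> = ?\<rho> * d" using N by (metis less_irrefl mult.assoc nonzero_mult_div_cancel_left times_divide_eq_right)
    finally have "?F Zs - ?F ?Z' \<le> (?F Zs - ?F ?Z) * (1 + - (d / ?N))"
      using gain by (simp add: algebra_simps)
    also have "\<dots> \<le> (?F Zs - ?F ?Z) * exp (- (d / ?N))"
      using False by (intro mult_left_mono exp_ge_add_one_self) auto
    also have "\<dots> \<le> (?F Zs - ?F Y) * exp (- (cost ?Z - cost Y) / ?N) * exp (- (d / ?N))"
      using gap by (intro mult_right_mono) auto
    also have "\<dots> = (?F Zs - ?F Y) * exp (- (cost ?Z' - cost Y) / ?N)"
      unfolding mult.assoc exp_add[symmetric] d_def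
      by (simp add: add_divide_distrib[symmetric] minus_divide_left del: add_divide_distrib)
    finally show ?thesis .
  qed
qed

section \<open>Feasibility and termination of the greedy phase\<close>

lemma greedy_steps_wf:
  assumes "(greedy_step G k)\<^sup>*\<^sup>* st st'" and "wf_state G k st"
  shows "wf_state G k st'"
  using assms
proof (induction rule: rtranclp_induct)
  case (step st' st'')
  then show ?case
    by (cases st'; cases st'') (auto elim!: greedy_step_cases)
qed

lemma wf_start:
  assumes "(A, S) \<in> feasible G k"
  shows "wf_state G k (A, S, nodes G - A, (nodes G \<times> nodes G - edges G) - S)"
  using assms by (simp add: wf_state_def)

lemma greedy_completion_feasible:
  assumes "greedy_completion G k s s'" and "s \<in> feasible G k"
  shows "s' \<in> feasible G k"
  using assms greedy_steps_wf[OF _ wf_start]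
  by (cases s; cases s') (fastforce simp: greedy_completion_def wf_state_def)

text \<open>Every step lowers \<open>card U + card T\<close>, and while a move exists, finiteness
  provides a best one. This ensures that the algorithm has an output at all.\<close>

lemma greedy_terminates:
  assumes "wf_state G k st"
  shows "\<exists>st'. (greedy_step G k)\<^sup>*\<^sup>* st st' \<and> moves G st' = {}"
  using assms
proof (induction "case st of (A, S, U, T) \<Rightarrow> card U + card T" arbitrary: st rule: less_induct)
  case less
  obtain A S U T where st: "st = (A, S, U, T)" by (cases st)
  show ?case
  proof (cases "moves G st = {}")
    case False
    have "finite U" "finite T" "finite A"
      using less.prems finite_nodes finite_subset[of T "nodes G \<times> nodes G"]
      by (auto simp: st wf_state_def feasible_def intro: finite_subset)
    then have "finite (moves G st)" using finite_nodes by (simp add: st moves_def)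
    then obtain m where m: "best_move G st m"
      using ex_is_arg_max_if_finite[OF _ False] by (auto simp: best_move_def st)
    have "\<exists>st'. greedy_step G k st st'"
    proof (cases m)
      case (Add_Node a)
      with m have "best_move G (A, S, U, T) (Add_Node a)" by (simp add: st)
      from greedy_step.add_node[OF this] show ?thesis unfolding st by (rule exI)
    next
      case (Add_Edge e)
      with m have "best_move G (A, S, U, T) (Add_Edge e)" by (simp add: st)
      from greedy_step.add_edge[OF this] show ?thesis unfolding st by (rule exI)
    next
      case (Add_Both e)
      with m have "best_move G (A, S, U, T) (Add_Both (fst e, snd e))" by (simp add: st)
      from greedy_step.add_both[OF this] show ?thesis unfolding st by (rule exI)
    qed
    then obtain st' where step: "greedy_step G k st st'" by blast
    obtain A' S' U' T' where st': "st' = (A', S', U', T')" by (cases st')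
    have "card U' + card T' < card U + card T \<and> wf_state G k st'"
      using step less.prems unfolding st st' by (elim greedy_step_cases) auto
    then obtain st'' where "(greedy_step G k)\<^sup>*\<^sup>* st' st''" "moves G st'' = {}"
      using less.hyps[of st'] by (auto simp: st st')
    then show ?thesis using step by (meson converse_rtranclp_into_rtranclp)
  qed blast
qed

lemma greedy_completion_exists:
  assumes "s \<in> feasible G k"
  shows "\<exists>s'. greedy_completion G k s s'"
proof -
  obtain A S where s: "s = (A, S)" by (cases s)
  from greedy_terminates[OF wf_start] assms obtain A' S' U' T' where
    "(greedy_step G k)\<^sup>*\<^sup>* (A, S, nodes G - A, (nodes G \<times> nodes G - edges G) - S) (A', S', U', T')"
    "moves G (A', S', U', T') = {}"
    unfolding s by (metis prod.exhaust)
  then have "greedy_completion G k s (A', S')" unfolding greedy_completion_def s by blast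
  then show ?thesis ..
qed

text \<open>
  Until an item of the optimum is rejected for the first time, the gap to the optimum decays
  exponentially in the cost spent, and this extends to the rejected move, which would overrun the
  budget. The rejected move itself is worth at most half of the seed, and
  \<open>1 / 2 \<le> exp (- 1 / slack)\<close>.
\<close>

lemma greedy_completion_bound:
  assumes opt: "(A_opt, S_opt) \<in> feasible G k" and "c \<le> 1"
    and start: "(A\<^sub>0, S\<^sub>0) \<in> feasible G k" and sub: "A\<^sub>0 <+> S\<^sub>0 \<subseteq> A_opt <+> S_opt"
    and seed: "\<And>D. D \<subseteq> A_opt <+> S_opt \<Longrightarrow> source_closed D \<Longrightarrow> card D \<le> 2 \<Longrightarrow>
      2 * (item_spread G ((A\<^sub>0 <+> S\<^sub>0) \<union> D) - item_spread G (A\<^sub>0 <+> S\<^sub>0)) \<le>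
      item_spread G (A\<^sub>0 <+> S\<^sub>0)"
    and completion: "greedy_completion G k (A\<^sub>0, S\<^sub>0) (A', S')"
  shows "(1 - exp (- 1 / slack)) * item_spread G (A_opt <+> S_opt) \<le> item_spread G (A' <+> S')"
proof -
  define Zs where "Zs = A_opt <+> S_opt"
  define Y where "Y = A\<^sub>0 <+> S\<^sub>0"
  define q where "q = exp (- 1 / slack)"
  let ?F = "item_spread G" and ?N = "slack * cost (Zs - Y)"
  have Zs: "Zs \<subseteq> ground" "source_closed Zs" "cost Zs \<le> real k"
    using feasibleD[OF opt] by (auto simp: Zs_def)
  have YZs: "Y \<subseteq> Zs" using sub by (simp add: Y_def Zs_def)
  have FY: "?F Y \<le> ?F Zs" using YZs Zs by (intro item_spread_mono finite_nodes) auto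
  \<comment> \<open>\<open>1 / slack = c / (1 + c)\<close> is at most one half because
    \<open>c \<le> 1\<close>; then \<open>exp (- x) \<ge> 1 - x\<close> bounds \<open>q\<close> from
    below.\<close>
  have "1 / slack \<le> 1 / 2" using \<open>c \<le> 1\<close> c_pos by (simp add: slack_def field_simps)
  then have q: "1 / 2 \<le> q" using exp_ge_add_one_self[of "- 1 / slack"] by (simp add: q_def)
  have FZs: "0 \<le> ?F Zs" using item_spread_mono[OF finite_nodes, of "{}" Zs] Zs by simp
  \<comment> \<open>The first disjunct is the goal itself and persists because the spread never
    drops. The second describes the run while every item of \<open>Zs\<close> is owned or available;
    its exponent counts only the cost spent beyond the seed \<open>Y\<close>.\<close>
  define good where "good = (\<lambda>(A, S, U, T).
    (1 - q) * ?F Zs \<le> ?F (A <+> S) \<or>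
    Zs \<subseteq> (A <+> S) \<union> (U <+> T) \<and>
      ?F Zs - ?F (A <+> S) \<le> (?F Zs - ?F Y) * exp (- (cost (A <+> S) - cost Y) / ?N))"
  have inv: "wf_state G k st \<and> (case st of (A, S, U, T) \<Rightarrow> Y \<subseteq> A <+> S) \<and> good st"
    if "(greedy_step G k)\<^sup>*\<^sup>*
          (A\<^sub>0, S\<^sub>0, nodes G - A\<^sub>0, (nodes G \<times> nodes G - edges G) - S\<^sub>0) st" for st
    using that
  proof (induction rule: rtranclp_induct)
    case base
    have "Zs \<subseteq> (A\<^sub>0 <+> S\<^sub>0) \<union> ((nodes G - A\<^sub>0) <+> (nodes G \<times> nodes G - edges G - S\<^sub>0))"
      using opt by (auto simp: Zs_def feasible_def)
    then show ?case using wf_start[OF start] by (simp add: good_def Y_def)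
  next
    case (step st st')
    obtain A S U T where st: "st = (A, S, U, T)" by (cases st)
    obtain A' S' U' T' where st': "st' = (A', S', U', T')" by (cases st')
    have wf: "wf_state G k (A, S, U, T)" and Y: "Y \<subseteq> A <+> S" and good: "good (A, S, U, T)"
      using step.IH by (auto simp: st)
    have "(A, S) \<in> feasible G k" using wf by (simp add: wf_state_def)
    note Z = feasibleD(1)[OF this]
    from step.hyps(2)[unfolded st st'] wf show ?case
    proof (cases rule: greedy_step_cases)
      case (accept m)
      have "(A', S') \<in> feasible G k" using accept(2) by (simp add: wf_state_def)
      from feasibleD(1)[OF this] have "?F (A <+> S) \<le> ?F (A' <+> S')"
        using accept(3) by (intro item_spread_mono finite_nodes) auto
      then have "good (A', S', U', T')"
        using good gap_step[OF wf accept(1) Zs(2) _ Y FY] accept(3,4) by (fastforce simp: good_def)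
      then show ?thesis using accept Y by (auto simp: st')
    next
      case (reject m)
      let ?Z' = "(A <+> S) \<union> move_items m"
      have "good (A', S', U', T')"
      proof (cases "(1 - q) * ?F Zs \<le> ?F (A <+> S) \<or> move_pivot m \<notin> Zs")
        case True
        then show ?thesis using good reject(3,5) by (auto simp: good_def)
      next
        case False
        then have piv: "move_pivot m \<in> Zs" and avail: "Zs \<subseteq> (A <+> S) \<union> (U <+> T)"
          and gap: "?F Zs - ?F (A <+> S) \<le>
            (?F Zs - ?F Y) * exp (- (cost (A <+> S) - cost Y) / ?N)"
          using good by (auto simp: good_def)
        \<comment> \<open>Losing an item outside \<open>Zs\<close> was harmless. Here the pivot lies
          in \<open>Zs\<close>, and closure puts the whole move inside \<open>Zs\<close>, where the
          hypothesis on the seed applies to it.\<close>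
        have items: "move_items m \<subseteq> Zs" using move_items_subset[OF Zs(2) piv] .
        \<comment> \<open>The pivot is a missing item of \<open>Zs\<close> with positive price,
          which excludes \<open>?N = 0\<close>.\<close>
        have "move_pivot m \<notin> A <+> S" using wf reject(6) by (auto simp: wf_state_def)
        then have "move_pivot m \<in> Zs - Y" using piv Y by auto
        then have "0 < cost (Zs - Y)"
          using Zs finite_ground by (intro sum_pos2[of _ "move_pivot m"])
            (auto intro: finite_subset item_cost_pos less_imp_le)
        then have N: "0 < ?N" using slack_ge_1 by (intro mult_pos_pos) auto
        \<comment> \<open>\<open>Zs\<close> fits the budget and the rejected move overruns it, so
          the move would bring the cost beyond the seed to at least \<open>cost (Zs - Y)\<close>;
          the exponent is then at most \<open>- 1 / slack\<close>.\<close>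
        have "cost (Zs - Y) = cost Zs - cost Y"
          using YZs Zs finite_subset[OF _ finite_ground] by (intro sum_diff) auto
        then have "cost (Zs - Y) \<le> cost ?Z' - cost Y" using Zs(3) reject(4) by simp
        moreover have "1 / slack * ?N = cost (Zs - Y)" using slack_ge_1 by simp
        ultimately have "1 / slack * ?N \<le> cost ?Z' - cost Y" by linarith
        then have "1 / slack \<le> (cost ?Z' - cost Y) / ?N"
          using N by (subst pos_le_divide_eq) auto
        then have "- (cost ?Z' - cost Y) / ?N \<le> - 1 / slack"
          unfolding minus_divide_left[symmetric] by (rule le_imp_neg_le)
        then have "exp (- (cost ?Z' - cost Y) / ?N) \<le> q" unfolding q_def exp_le_cancel_iff .
        then have "(?F Zs - ?F Y) * exp (- (cost ?Z' - cost Y) / ?N) \<le> (?F Zs - ?F Y) * q"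
          using FY by (intro mult_left_mono) auto
        then have "?F Zs - ?F ?Z' \<le> (?F Zs - ?F Y) * q"
          using gap_step[OF wf reject(1) Zs(2) avail Y FY gap] by linarith
        \<comment> \<open>The estimate for \<open>?Z'\<close> is carried back to the actual
          solution. The rejected move gains no more than it would over the seed, hence at most
          \<open>?F Y / 2\<close>, and the term \<open>- q * ?F Y\<close> of the decay bound absorbs
          this since \<open>1 / 2 \<le> q\<close>.\<close>
        moreover have "?F ?Z' - ?F (A <+> S) \<le> ?F (Y \<union> move_items m) - ?F Y"
          using Y Z items Zs by (intro item_spread_diminishing finite_nodes) auto
        moreover have "2 * (?F (Y \<union> move_items m) - ?F Y) \<le> ?F Y"
          using seed[OF items[unfolded Zs_def] source_closed_move_items card_move_items_le]
          by (simp add: Y_def)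
        moreover have "0 \<le> (q - 1 / 2) * ?F Y"
          using q item_spread_mono[OF finite_nodes, of "{}" Y] YZs Zs by simp
        ultimately have "(1 - q) * ?F Zs \<le> ?F (A <+> S)" by (simp add: algebra_simps)
        then show ?thesis by (simp add: good_def reject(3))
      qed
      then show ?thesis using reject Y by (auto simp: st')
    qed
  qed
  from completion obtain U' T' where
    run: "(greedy_step G k)\<^sup>*\<^sup>* (A\<^sub>0, S\<^sub>0, nodes G - A\<^sub>0, (nodes G \<times> nodes G - edges G) - S\<^sub>0)
            (A', S', U', T')" and stop: "moves G (A', S', U', T') = {}"
    by (auto simp: greedy_completion_def)
  have final: "(A', S') \<in> feasible G k" "T' \<subseteq> nodes G \<times> nodes G" "good (A', S', U', T')"
    using inv[OF run] by (auto simp: wf_state_def)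
  have "(1 - q) * ?F Zs \<le> ?F (A' <+> S')"
  proof (cases "Zs \<subseteq> (A' <+> S') \<union> (U' <+> T')")
    case True
    \<comment> \<open>Edges may be left in \<open>T'\<close>, but only with sources outside
      \<open>A'\<close>. As \<open>U'\<close> is empty, every node of \<open>Zs\<close> is a seed,
      so none of these edges belongs to \<open>Zs\<close>.\<close>
    have U': "U' = {}" and T': "(A' \<times> nodes G) \<inter> T' = {}" using stop by (auto simp: moves_def)
    have "Zs \<subseteq> A' <+> S'"
    proof
      fix z assume z: "z \<in> Zs"
      show "z \<in> A' <+> S'"
      proof (cases z)
        case (Inr e)
        then have "Inl (fst e) \<in> Zs" using z Zs(2) unfolding source_closed_def by blast
        then have "fst e \<in> A'" using True U' by auto
        then have "e \<notin> T'" using T' final(2) by (cases e) auto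
        then show ?thesis using z True Inr by auto
      qed (use z True U' in auto)
    qed
    then have "?F Zs \<le> ?F (A' <+> S')"
      using feasibleD[OF final(1)] by (intro item_spread_mono finite_nodes) auto
    moreover have "0 \<le> q * ?F Zs" using FZs q by simp
    ultimately show ?thesis by (simp add: algebra_simps)
  qed (use final in \<open>auto simp: good_def\<close>)
  then show ?thesis by (simp add: q_def Zs_def)
qed

section \<open>The enumeration algorithm\<close>

lemma finite_feasible: "finite (feasible G k)"
proof (rule finite_subset)
  show "feasible G k \<subseteq> Pow (nodes G) \<times> Pow (nodes G \<times> nodes G)"
    by (auto simp: feasible_def)
qed (use finite_nodes in auto)

lemma enumeration_output_exists:
  assumes "0 < M"
  shows "\<exists>s. enumeration_output G k M s"
proof -
  have fin: "finite (small_solutions G k M)" "finite (start_solutions G k M)"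
    using finite_feasible by (auto simp: small_solutions_def start_solutions_def intro: finite_subset)
  have "({}, {}) \<in> small_solutions G k M"
    using assms by (simp add: small_solutions_def feasible_def total_cost_def)
  then obtain s1 where s1: "is_arg_max (spread G) (\<lambda>s. s \<in> small_solutions G k M) s1"
    using ex_is_arg_max_if_finite[OF fin(1)] by blast
  have "\<forall>s\<in>start_solutions G k M. \<exists>s'. greedy_completion G k s s'"
    using greedy_completion_exists by (auto simp: start_solutions_def)
  then obtain h where h: "\<forall>s\<in>start_solutions G k M. greedy_completion G k s (h s)" by metis
  show ?thesis
  proof (cases "start_solutions G k M = {}")
    case True
    then show ?thesis using s1 h unfolding enumeration_output_def by metis
  next
    case False
    then obtain s2 where s2: "is_arg_max (spread G) (\<lambda>s. s \<in> h ` start_solutions G k M) s2"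
      using ex_is_arg_max_if_finite[of "h ` start_solutions G k M"] fin by blast
    obtain s where "is_arg_max (spread G) (\<lambda>s. s \<in> {s1, s2}) s"
      using ex_is_arg_max_if_finite[of "{s1, s2}"] by blast
    then show ?thesis using s1 s2 h False unfolding enumeration_output_def by metis
  qed
qed

text \<open>Separates the guarantee from tie-breaking. A start solution may have several
  completions, and the output is compared only with the one recorded by \<open>h\<close>; hence the
  existential form of the third fact.\<close>

lemma enumeration_output_properties:
  assumes "enumeration_output G k M s"
  shows "s \<in> feasible G k"
    and "\<And>s'. s' \<in> small_solutions G k M \<Longrightarrow> spread G s' \<le> spread G s"
    and "\<And>s'. s' \<in> start_solutions G k M \<Longrightarrow>
           \<exists>s''. greedy_completion G k s' s'' \<and> spread G s'' \<le> spread G s"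
proof -
  obtain s1 h where s1: "is_arg_max (spread G) (\<lambda>s. s \<in> small_solutions G k M) s1"
    and h: "\<forall>s\<in>start_solutions G k M. greedy_completion G k s (h s)"
    and s: "if start_solutions G k M = {} then s = s1
         else \<exists>s2. is_arg_max (spread G) (\<lambda>s. s \<in> h ` start_solutions G k M) s2 \<and>
                     is_arg_max (spread G) (\<lambda>s. s \<in> {s1, s2}) s"
    using assms unfolding enumeration_output_def by blast
  have feas1: "s1 \<in> feasible G k" using s1 by (auto simp: is_arg_max_def small_solutions_def)
  have feas2: "h s' \<in> feasible G k" if "s' \<in> start_solutions G k M" for s'
  proof (rule greedy_completion_feasible)
    show "greedy_completion G k s' (h s')" using h that by blast
    show "s' \<in> feasible G k" using that by (auto simp: start_solutions_def)
  qed
  show "s \<in> feasible G k"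
    using s feas1 feas2 by (auto simp: is_arg_max_def split: if_splits)
  have "spread G s1 \<le> spread G s"
    using s is_arg_max_ge[where y = s1] by (metis insertI1 order_refl)
  then show "spread G s' \<le> spread G s" if "s' \<in> small_solutions G k M" for s'
    using is_arg_max_ge[OF s1 that] by simp
  show "\<exists>s''. greedy_completion G k s' s'' \<and> spread G s'' \<le> spread G s"
    if s': "s' \<in> start_solutions G k M" for s'
  proof -
    obtain s2 where s2: "is_arg_max (spread G) (\<lambda>s. s \<in> h ` start_solutions G k M) s2"
      "is_arg_max (spread G) (\<lambda>s. s \<in> {s1, s2}) s"
      using s s' by (auto split: if_splits)
    have "spread G (h s') \<le> spread G s2" by (rule is_arg_max_ge[OF s2(1)]) (use s' in blast)
    also have "spread G s2 \<le> spread G s" by (rule is_arg_max_ge[OF s2(2)]) simp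
    finally show ?thesis using h s' by blast
  qed
qed

text \<open>An optimum with fewer than \<open>M\<close> items competes in the search over small
  solutions. A larger one contains a seed that is itself a start solution, and the completion of
  that single seed is already good enough.\<close>

lemma enumeration_output_bound:
  assumes out: "enumeration_output G k M s" and opt: "(A_opt, S_opt) \<in> feasible G k"
    and "4 \<le> M" and "c \<le> 1"
  shows "(1 - exp (- 1 / slack)) * spread G (A_opt, S_opt) \<le> spread G s"
proof (cases "card A_opt + card S_opt < M")
  case True
  then have "spread G (A_opt, S_opt) \<le> spread G s"
    using opt enumeration_output_properties(2)[OF out] by (auto simp: small_solutions_def)
  moreover have "0 \<le> spread G (A_opt, S_opt)"
    by (auto simp: spread_def intro!: sum_nonneg)
  then have "(1 - exp (- 1 / slack)) * spread G (A_opt, S_opt) \<le> 1 * spread G (A_opt, S_opt)"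
    by (intro mult_right_mono) auto
  ultimately show ?thesis by linarith
next
  case False
  note O = feasibleD[OF opt]
  have "M \<le> card (A_opt <+> S_opt)" using False O by (simp add: card_Plus)
  from obtain_seed[OF finite_nodes O(2,1) \<open>4 \<le> M\<close> this] obtain Y where
    Y: "Y \<subseteq> A_opt <+> S_opt" "source_closed Y" "card Y = M"
    and seed: "\<And>D. D \<subseteq> A_opt <+> S_opt \<Longrightarrow> source_closed D \<Longrightarrow> card D \<le> 2 \<Longrightarrow>
           2 * (item_spread G (Y \<union> D) - item_spread G Y) \<le> item_spread G Y" by metis
  \<comment> \<open>The seed is read back as a pair; source-closedness supplies the condition that
    the edges of \<open>S\<close> leave \<open>A\<close>.\<close>
  define A S where "A = Inl -` Y" and "S = Inr -` Y"
  have YAS: "Y = A <+> S"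
  proof (intro equalityI subsetI)
    fix z assume "z \<in> Y"
    then show "z \<in> A <+> S" by (cases z) (auto simp: A_def S_def)
  qed (auto simp: A_def S_def)
  have sub: "A \<subseteq> A_opt" "S \<subseteq> S_opt" using Y by (auto simp: A_def S_def)
  then have fin: "finite A" "finite S" using O finite_subset by blast+
  have "total_cost G (A, S) \<le> cost (A_opt <+> S_opt)"
    using total_cost_eq_item_cost[OF fin, of G] cost_mono[OF Y(1) O(1)] YAS by simp
  moreover have "S \<subseteq> A \<times> nodes G - edges G"
  proof
    fix e assume e: "e \<in> S"
    then have "Inl (fst e) \<in> Y" using Y(2) unfolding source_closed_def S_def by blast
    then show "e \<in> A \<times> nodes G - edges G"
      using e sub opt by (auto simp: feasible_def A_def mem_Times_iff)
  qed
  ultimately have feas: "(A, S) \<in> feasible G k"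
    using O(3) sub opt by (auto simp: feasible_def)
  moreover have "card A + card S = M" using Y(3) fin by (simp add: YAS card_Plus)
  ultimately have "(A, S) \<in> start_solutions G k M" by (simp add: start_solutions_def)
  then obtain A' S' where compl: "greedy_completion G k (A, S) (A', S')"
    and le: "spread G (A', S') \<le> spread G s"
    using enumeration_output_properties(3)[OF out] by (metis surj_pair)
  have "(1 - exp (- 1 / slack)) * item_spread G (A_opt <+> S_opt) \<le> item_spread G (A' <+> S')"
    using Y seed unfolding YAS by (intro greedy_completion_bound[OF opt \<open>c \<le> 1\<close> feas _ _ compl]) auto
  then show ?thesis
    using le O(4) feasibleD(4)[OF greedy_completion_feasible[OF compl feas]] by simp
qed

end

theorem theorem5:
  fixes G :: "'v instance_graph" and c\<^sub>m\<^sub>i\<^sub>n :: real and k M :: nat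
  assumes "valid_instance G"
    and "0 < c\<^sub>m\<^sub>i\<^sub>n" and "c\<^sub>m\<^sub>i\<^sub>n \<le> 1"
    and "\<forall>e \<in> nodes G \<times> nodes G. c\<^sub>m\<^sub>i\<^sub>n \<le> edge_cost G e"
    and "M \<ge> 4"
  shows "(\<exists>A S. enumeration_output G k M (A, S)) \<and>
         (\<forall>A S A_opt S_opt.
            enumeration_output G k M (A, S) \<longrightarrow> optimal G k (A_opt, S_opt) \<longrightarrow>
              (A, S) \<in> feasible G k \<and>
              total_cost G (A, S) \<le> real k \<and>
              spread G (A, S) \<ge>
                (1 - 1 / exp (c\<^sub>m\<^sub>i\<^sub>n / (1 + c\<^sub>m\<^sub>i\<^sub>n))) * spread G (A_opt, S_opt))"
proof -
  interpret augmentation_instance G c\<^sub>m\<^sub>i\<^sub>n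
    using assms by unfold_locales auto
  have factor: "exp (- 1 / slack) = 1 / exp (c\<^sub>m\<^sub>i\<^sub>n / (1 + c\<^sub>m\<^sub>i\<^sub>n))"
    by (simp add: slack_def exp_minus inverse_eq_divide)
  have "\<exists>s. enumeration_output G k M s"
    using assms(5) by (intro enumeration_output_exists) simp
  moreover have "(A, S) \<in> feasible G k \<and> total_cost G (A, S) \<le> real k \<and>
      (1 - 1 / exp (c\<^sub>m\<^sub>i\<^sub>n / (1 + c\<^sub>m\<^sub>i\<^sub>n))) * spread G (A_opt, S_opt) \<le> spread G (A, S)"
    if out: "enumeration_output G k M (A, S)" and opt: "optimal G k (A_opt, S_opt)"
    for A S A_opt S_opt
  proof -
    have "(A_opt, S_opt) \<in> feasible G k" using opt by (simp add: optimal_def is_arg_max_def)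
    then show ?thesis
      using enumeration_output_bound[OF out _ assms(5,3)] enumeration_output_properties(1)[OF out]
      unfolding factor by (auto simp: feasible_def)
  qed
  ultimately show ?thesis by auto
qed

end
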